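(* For all integers $k\geq 2$, \[ f_2(k)\leq 6k(k+1)(k+2). \]
   Context: For positive integers $r,n$, an $r$-coloring of a set $A\subseteq\mathbb{N}=\{1,2,\ldots\}$ is a function $\Delta:A\to\{0,1,\ldots,r-1\}$. A tuple $(a_1,\ldots,a_k,b)$ of elements of $A$ is a monochromatic solution to an equation $G(x_1,\ldots,x_k,y)=0$ if $G(a_1,\ldots,a_k,b)=0$ and $\Delta(a_1)=\cdots=\Delta(a_k)=\Delta(b)$. For integers $r,k\geq 2$, $f_r(k)$ denotes the smallest positive integer $n$ such that every $r$-coloring of $\{1,2,\ldots,n\}$ has a monochromatic solution to $1/x_1+\cdots+1/x_k=1/y$, where $x_1,\ldots,x_k$ are not necessarily distinct. *)

theory Defs
  imports Complex_Main "HOL-Library.FuncSet"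
begin

definition coloring :: "nat \<Rightarrow> nat set \<Rightarrow> (nat \<Rightarrow> nat) \<Rightarrow> bool" where
  "coloring r A \<Delta> \<longleftrightarrow> \<Delta> \<in> A \<rightarrow> {0..<r}"

definition unit_fraction_eq :: "nat \<Rightarrow> (nat \<Rightarrow> nat) \<Rightarrow> nat \<Rightarrow> bool" where
  "unit_fraction_eq k x y \<longleftrightarrow> (\<Sum>i = 1..k. 1 / real (x i)) = 1 / real y"

text \<open>A tuple \<open>(a\<^sub>1, \<dots>, a\<^sub>k)\<close> is represented by a function \<open>a\<close>
  of which only the values on \<open>{1..k}\<close> matter; they need not be distinct.\<close>

definition monochromatic_solution ::
    "nat set \<Rightarrow> (nat \<Rightarrow> nat) \<Rightarrow> nat \<Rightarrow> (nat \<Rightarrow> nat) \<Rightarrow> nat \<Rightarrow> bool" where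
  "monochromatic_solution A \<Delta> k a b \<longleftrightarrow>
     (\<forall>i \<in> {1..k}. a i \<in> A) \<and> b \<in> A \<and>
     unit_fraction_eq k a b \<and> (\<forall>i \<in> {1..k}. \<Delta> (a i) = \<Delta> b)"

definition forces_solution :: "nat \<Rightarrow> nat \<Rightarrow> nat \<Rightarrow> bool" where
  "forces_solution r k n \<longleftrightarrow>
     (\<forall>\<Delta>. coloring r {1..n} \<Delta> \<longrightarrow> (\<exists>a b. monochromatic_solution {1..n} \<Delta> k a b))"

text \<open>\<open>LEAST\<close> is unspecified when no such \<open>n\<close> exists, so results on \<open>f_num r k\<close>
  should assert that existence alongside.\<close>

definition f_num :: "nat \<Rightarrow> nat \<Rightarrow> nat" where
  "f_num r k = (LEAST n. n > 0 \<and> forces_solution r k n)"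

end

theory Submission
  imports Defs
begin

text \<open>Substituting \<open>x = L / d\<close> for divisors \<open>d\<close> of \<open>L\<close> turns the equation into
  \<open>d\<^sub>1 + \<dots> + d\<^sub>k = d\<close>, so it suffices to find a monochromatic solution of the latter among the
  divisors of some \<open>L \<le> 6k(k + 1)(k + 2)\<close>; at most three distinct summands are ever needed.
  For \<open>k \<ge> 3\<close> take \<open>L = 6k(k + 1)(k + 2)\<close>. If there is no solution then \<open>1, 2\<close> differ in colour,
  and so do \<open>3, 6\<close>, because otherwise \<open>e, 2e\<close> force \<open>(k + 1)e\<close> and \<open>(k + 2)e\<close> to have the other
  colour, hence \<open>k(k + 1)e\<close> and \<open>k(k + 2)e\<close> the first one, although
  \<open>k(k + 2)e = k(k + 1)e + 2e + (k - 2)e\<close>. Both possible colours of \<open>3\<close> then lead to a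
  contradiction. For \<open>k = 2\<close> take \<open>L = 60\<close>.\<close>

text \<open>Multiplicities \<open>p\<close>, \<open>q\<close>, \<open>s\<close> stand in for a
  \<open>k\<close>-tuple of summands; any of them may be 0, so fewer distinct values are covered as
  well. A Boolean colour makes two values that differ from a third agree, which leaves propositional
  case analyses.\<close>

definition sum_free_on_divisors :: "nat \<Rightarrow> nat \<Rightarrow> (nat \<Rightarrow> bool) \<Rightarrow> bool" where
  "sum_free_on_divisors k L c \<longleftrightarrow>
     (\<forall>p q s u v w d. p + q + s = k \<longrightarrow> p * u + q * v + s * w = d \<longrightarrow>
        u dvd L \<longrightarrow> v dvd L \<longrightarrow> w dvd L \<longrightarrow> d dvd L \<longrightarrow> \<not> (c u = c d \<and> c v = c d \<and> c w = c d))"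

lemma sum_free_on_divisorsD:
  assumes "sum_free_on_divisors k L c" "p + q + s = k" "p * u + q * v + s * w = d"
    and "u dvd L" "v dvd L" "w dvd L" "d dvd L"
  shows "\<not> (c u = c d \<and> c v = c d \<and> c w = c d)"
  using assms unfolding sum_free_on_divisors_def by blast

lemma sum_free_on_divisors_multiple:
  assumes "sum_free_on_divisors k L c" "k * u dvd L"
  shows "c (k * u) \<noteq> c u"
  using sum_free_on_divisorsD[OF assms(1), of k 0 0 u u u "k * u"] assms(2)
  by (auto dest: dvd_mult_right)

lemma sum_split_three:
  fixes g :: "nat \<Rightarrow> 'a::semiring_1"
  shows "(\<Sum>i = 1..p + q + s. g (if i \<le> p then u else if i \<le> p + q then v else w))
    = of_nat p * g u + of_nat q * g v + of_nat s * g w"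
proof -
  have 1: "(\<Sum>i = 1..p. g (if i \<le> p then u else if i \<le> p + q then v else w)) = of_nat p * g u"
    by simp
  have 2: "(\<Sum>i = p + 1..p + q. g (if i \<le> p then u else if i \<le> p + q then v else w))
      = of_nat q * g v"
    by simp
  have 3: "(\<Sum>i = p + q + 1..p + q + s. g (if i \<le> p then u else if i \<le> p + q then v else w))
      = of_nat s * g w"
    by simp
  show ?thesis
    using 1 2 3 by (simp add: sum.ub_add_nat)
qed

lemma unsolvable_imp_sum_free_on_divisors:
  assumes col: "coloring 2 {1..n} \<Delta>" and L: "0 < L" "L \<le> n"
    and unsolvable: "\<nexists>a b. monochromatic_solution {1..n} \<Delta> k a b"
  shows "sum_free_on_divisors k L (\<lambda>d. \<Delta> (L div d) = 0)"
  unfolding sum_free_on_divisors_def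
proof (intro allI impI notI)
  fix p q s u v w d
  assume k: "p + q + s = k" and eq: "p * u + q * v + s * w = d"
    and dvd: "u dvd L" "v dvd L" "w dvd L" "d dvd L"
    and c: "(\<Delta> (L div u) = 0) = (\<Delta> (L div d) = 0) \<and> (\<Delta> (L div v) = 0) = (\<Delta> (L div d) = 0)
      \<and> (\<Delta> (L div w) = 0) = (\<Delta> (L div d) = 0)"
  have in_range: "L div t \<in> {1..n}" if "t dvd L" for t
  proof -
    have "0 < L div t" using that L by (auto elim!: dvdE)
    moreover have "L div t \<le> n" using L div_le_dividend le_trans by blast
    ultimately show ?thesis by simp
  qed
  have lt2: "\<Delta> (L div t) < 2" if "t dvd L" for t
    using col in_range[OF that] unfolding coloring_def by auto
  \<comment> \<open>With only the colours 0 and 1, agreeing on being 0 is agreeing.\<close>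
  have mono: "\<Delta> (L div u) = \<Delta> (L div d)" "\<Delta> (L div v) = \<Delta> (L div d)"
    "\<Delta> (L div w) = \<Delta> (L div d)"
    using lt2[OF dvd(1)] lt2[OF dvd(2)] lt2[OF dvd(3)] lt2[OF dvd(4)] c by linarith+
  have inv: "1 / real (L div t) = real t / real L" if "t dvd L" for t
    using that L by (simp add: real_of_nat_div)
  define a where "a i = L div (if i \<le> p then u else if i \<le> p + q then v else w)" for i
  have "(\<Sum>i = 1..k. 1 / real (a i))
      = real p * (1 / real (L div u)) + real q * (1 / real (L div v)) + real s * (1 / real (L div w))"
    unfolding a_def k[symmetric] by (rule sum_split_three)
  also have "\<dots> = real d / real L"
    unfolding inv[OF dvd(1)] inv[OF dvd(2)] inv[OF dvd(3)] eq[symmetric]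
    by (simp add: add_divide_distrib)
  also have "\<dots> = 1 / real (L div d)"
    using inv[OF dvd(4)] by simp
  finally have "monochromatic_solution {1..n} \<Delta> k a (L div d)"
    using in_range dvd mono
    unfolding monochromatic_solution_def unit_fraction_eq_def a_def by auto
  with unsolvable show False by blast
qed

lemma sum_free_double_ne:
  assumes sf: "sum_free_on_divisors k L c" and "k \<ge> 2" and dvd: "2 * e * k * (k + 1) * (k + 2) dvd L"
  shows "c e \<noteq> c (2 * e)"
proof
  assume eq: "c e = c (2 * e)"
  obtain m where k: "k = m + 2" using \<open>k \<ge> 2\<close> by (metis add.commute le_Suc_ex)
  have D: "t dvd L" if "t dvd 2 * e * k * (k + 1) * (k + 2)" for t
    using that dvd dvd_trans by blast
  have d: "e dvd L" "2 * e dvd L" "(k + 1) * e dvd L" "(k + 2) * e dvd L"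
    "k * ((k + 1) * e) dvd L" "k * ((k + 2) * e) dvd L"
  proof -
    have "2 * e * k * (k + 1) * (k + 2) = e * (2 * k * (k + 1) * (k + 2))"
      "2 * e * k * (k + 1) * (k + 2) = 2 * e * (k * (k + 1) * (k + 2))"
      "2 * e * k * (k + 1) * (k + 2) = (k + 1) * e * (2 * k * (k + 2))"
      "2 * e * k * (k + 1) * (k + 2) = (k + 2) * e * (2 * k * (k + 1))"
      "2 * e * k * (k + 1) * (k + 2) = k * ((k + 1) * e) * (2 * (k + 2))"
      "2 * e * k * (k + 1) * (k + 2) = k * ((k + 2) * e) * (2 * (k + 1))"
      by (simp_all add: algebra_simps)
    then show "e dvd L" "2 * e dvd L" "(k + 1) * e dvd L" "(k + 2) * e dvd L"
      "k * ((k + 1) * e) dvd L" "k * ((k + 2) * e) dvd L"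
      by (metis D dvd_triv_left)+
  qed
  \<comment> \<open>The sums are (k+1)e = (k-1)e + 2e and, next, (k+2)e = (k-2)e + 2(2e).\<close>
  have "c ((k + 1) * e) \<noteq> c e"
    using sum_free_on_divisorsD[OF sf, of "m + 1" 1 0 e "2 * e" e "(k + 1) * e"] d eq
    by (auto simp: k algebra_simps)
  moreover have "c ((k + 2) * e) \<noteq> c e"
    using sum_free_on_divisorsD[OF sf, of m 2 0 e "2 * e" e "(k + 2) * e"] d eq
    by (auto simp: k algebra_simps)
  moreover have "c (k * ((k + 1) * e)) \<noteq> c ((k + 1) * e)" "c (k * ((k + 2) * e)) \<noteq> c ((k + 2) * e)"
    using sum_free_on_divisors_multiple[OF sf] d by blast+
  moreover have "\<not> (c (k * ((k + 1) * e)) = c (k * ((k + 2) * e))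
      \<and> c (2 * e) = c (k * ((k + 2) * e)) \<and> c e = c (k * ((k + 2) * e)))"
    by (rule sum_free_on_divisorsD[OF sf, of 1 1 m]) (use d in \<open>auto simp: k algebra_simps\<close>)
  ultimately show False using eq by blast
qed

lemma not_sum_free_on_divisors:
  assumes "k \<ge> 3"
  shows "\<not> sum_free_on_divisors k (6 * k * (k + 1) * (k + 2)) c"
proof
  define L where "L = 6 * k * (k + 1) * (k + 2)"
  assume "sum_free_on_divisors k (6 * k * (k + 1) * (k + 2)) c"
  then have sf: "sum_free_on_divisors k L c" by (simp add: L_def)
  obtain m where k: "k = m + 3" using assms by (metis add.commute le_Suc_ex)
  have "L = 1 * L" "L = 2 * (3 * k * (k + 1) * (k + 2))" "L = 3 * (2 * k * (k + 1) * (k + 2))"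
    "L = 6 * (k * (k + 1) * (k + 2))" "L = k * 2 * (3 * (k + 1) * (k + 2))"
    "L = k * 6 * ((k + 1) * (k + 2))" "L = (k + 1) * (6 * k * (k + 2))"
    "L = (k + 2) * (6 * k * (k + 1))" "L = k * (k + 1) * (6 * (k + 2))"
    "L = 3 * (k + 1) * (2 * k * (k + 2))" "L = 2 * (k + 2) * (3 * k * (k + 1))"
    by (simp_all add: L_def algebra_simps)
  then have d: "1 dvd L" "2 dvd L" "3 dvd L" "6 dvd L" "k * 2 dvd L" "k * 6 dvd L" "k + 1 dvd L"
    "k + 2 dvd L" "k * (k + 1) dvd L" "3 * (k + 1) dvd L" "2 * (k + 2) dvd L"
    by (metis dvd_triv_left)+
  \<comment> \<open>The factor 6 in \<open>L\<close> is what the doubling lemma needs for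
    \<open>e = 3\<close>.\<close>
  have "2 * 1 * k * (k + 1) * (k + 2) * 3 = L" "2 * 3 * k * (k + 1) * (k + 2) * 1 = L"
    by (simp_all add: L_def)
  then have "2 * 1 * k * (k + 1) * (k + 2) dvd L" "2 * 3 * k * (k + 1) * (k + 2) dvd L"
    by (metis dvd_triv_left)+
  then have c12: "c 1 \<noteq> c 2" and c36: "c 3 \<noteq> c 6"
    using sum_free_double_ne[OF sf, of 1] sum_free_double_ne[OF sf, of 3] assms by simp_all
  have mult: "c (k * 2) \<noteq> c 2" "c (k * 6) \<noteq> c 6" "c (k * (k + 1)) \<noteq> c (k + 1)"
    using sum_free_on_divisors_multiple[OF sf] d by blast+
  show False
  proof (cases "c 1 = c 3")
    case True
    \<comment> \<open>Let 1, 3 have colour A and 2, 6 colour B. Then k+2 = (k-1) + 3 is B, k(k+1) =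
      (k-1)(k+2) + 2 is A, so k+1 is B. Now 3(k+1) = (k-2)2 + (k+1) + 6 must be A, but 2k is A and
      3(k+1) = 2k + (k-3) + 2*3 forbids that.\<close>
    have "\<not> (c 1 = c (k + 2) \<and> c 3 = c (k + 2) \<and> c 3 = c (k + 2))"
      by (rule sum_free_on_divisorsD[OF sf, of "m + 2" 1 0]) (use d in \<open>auto simp: k\<close>)
    moreover have "\<not> (c (k + 2) = c (k * (k + 1)) \<and> c 2 = c (k * (k + 1)) \<and> c 2 = c (k * (k + 1)))"
      by (rule sum_free_on_divisorsD[OF sf, of "m + 2" 1 0])
        (use d in \<open>auto simp: k algebra_simps\<close>)
    moreover have "\<not> (c 2 = c (3 * (k + 1)) \<and> c (k + 1) = c (3 * (k + 1)) \<and> c 6 = c (3 * (k + 1)))"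
      by (rule sum_free_on_divisorsD[OF sf, of "m + 1" 1 1]) (use d in \<open>auto simp: k\<close>)
    moreover have "\<not> (c (k * 2) = c (3 * (k + 1)) \<and> c 1 = c (3 * (k + 1)) \<and> c 3 = c (3 * (k + 1)))"
      by (rule sum_free_on_divisorsD[OF sf, of 1 m 2]) (use d in \<open>auto simp: k\<close>)
    ultimately show False using True c12 c36 mult by blast
  next
    case False
    \<comment> \<open>Here 1, 6 have one colour A and 2, 3 the other colour B.\<close>
    show False
    proof (cases "k = 3")
      case True
      then have "8 dvd L" by (simp add: L_def)
      \<comment> \<open>Both 8 = 6 + 1 + 1 and 8 = 3 + 3 + 2, so 8 can have neither colour.\<close>
      have "\<not> (c 6 = c 8 \<and> c 1 = c 8 \<and> c 1 = c 8)"
        by (rule sum_free_on_divisorsD[OF sf, of 1 2 0]) (use d \<open>8 dvd L\<close> True in auto)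
      moreover have "\<not> (c 3 = c 8 \<and> c 2 = c 8 \<and> c 2 = c 8)"
        by (rule sum_free_on_divisorsD[OF sf, of 2 1 0]) (use d \<open>8 dvd L\<close> True in auto)
      ultimately show False using False c12 c36 by blast
    next
      case k3: False
      then obtain l where l: "k = l + 4" using k by (cases m) auto
      \<comment> \<open>The first sum, 2(k+2) = (k-4)2 + 4*3, needs k at least 4 and gives A. Then
        3(k+1) = 2(k+2) + (k-1) is B, so 6k = 3(k+1) + (k-1)3 is A, the colour of 6, against
        \<open>mult\<close>.\<close>
      have "\<not> (c 2 = c (2 * (k + 2)) \<and> c 3 = c (2 * (k + 2)) \<and> c 3 = c (2 * (k + 2)))"
        by (rule sum_free_on_divisorsD[OF sf, of l 4 0]) (use d in \<open>auto simp: l\<close>)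
      moreover have "\<not> (c (2 * (k + 2)) = c (3 * (k + 1)) \<and> c 1 = c (3 * (k + 1))
          \<and> c 1 = c (3 * (k + 1)))"
        by (rule sum_free_on_divisorsD[OF sf, of 1 "l + 3" 0]) (use d in \<open>auto simp: l\<close>)
      moreover have "\<not> (c (3 * (k + 1)) = c (k * 6) \<and> c 3 = c (k * 6) \<and> c 3 = c (k * 6))"
        by (rule sum_free_on_divisorsD[OF sf, of 1 "l + 3" 0]) (use d in \<open>auto simp: l\<close>)
      ultimately show False using False c12 c36 mult by blast
    qed
  qed
qed

text \<open>If 1 has colour A, then 2 is B, 4 is A, 3 is B, 6 is A, 5 is B and 10 is A,
  contradicting 4 + 6 = 10. The divisors 5 and 10 are missing from 144, the value of the bound at k
  = 2.\<close>

lemma not_sum_free_on_divisors_60: "\<not> sum_free_on_divisors 2 60 c"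
proof
  assume sf: "sum_free_on_divisors 2 60 c"
  have pair: "\<not> (c u = c (u + v) \<and> c v = c (u + v))"
    if "u dvd 60" "v dvd 60" "u + v dvd 60" for u v
    using sum_free_on_divisorsD[OF sf, of 1 1 0 u v v "u + v"] that by auto
  have "c 2 \<noteq> c 1" "c 4 \<noteq> c 2" "c 6 \<noteq> c 3" "c 10 \<noteq> c 5"
    using pair[of 1 1] pair[of 2 2] pair[of 3 3] pair[of 5 5]
    by (simp_all add: numeral_2_eq_2[symmetric])
  moreover have "\<not> (c 1 = c 4 \<and> c 3 = c 4)" "\<not> (c 1 = c 5 \<and> c 4 = c 5)"
    "\<not> (c 4 = c 10 \<and> c 6 = c 10)"
    using pair[of 1 3] pair[of 1 4] pair[of 4 6] by simp_all
  ultimately show False by blast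
qed

lemma forces_solution_bound:
  assumes "k \<ge> 2"
  shows "forces_solution 2 k (6 * k * (k + 1) * (k + 2))"
  unfolding forces_solution_def
proof (intro allI impI, rule ccontr)
  fix \<Delta>
  assume col: "coloring 2 {1..6 * k * (k + 1) * (k + 2)} \<Delta>"
    and unsolvable: "\<nexists>a b. monochromatic_solution {1..6 * k * (k + 1) * (k + 2)} \<Delta> k a b"
  \<comment> \<open>\<open>L\<close> stays free, since k = 2 uses 60 inside the range up to
    144.\<close>
  note sf = unsolvable_imp_sum_free_on_divisors[OF col _ _ unsolvable]
  show False
  proof (cases "k = 2")
    case True
    then show False using sf[of 60] not_sum_free_on_divisors_60 by simp
  next
    case False
    then have "k \<ge> 3" using assms by simp
    then show False
      using sf[of "6 * k * (k + 1) * (k + 2)"] not_sum_free_on_divisors by simp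
  qed
qed

theorem theorem1p2:
  fixes k :: nat
  assumes "k \<ge> 2"
  shows "(\<exists>n > 0. forces_solution 2 k n) \<and> f_num 2 k \<le> 6 * k * (k + 1) * (k + 2)"
proof -
  have *: "0 < 6 * k * (k + 1) * (k + 2) \<and> forces_solution 2 k (6 * k * (k + 1) * (k + 2))"
    using forces_solution_bound[OF assms] assms by simp
  then show ?thesis
    unfolding f_num_def by (blast intro: Least_le)
qed

end
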